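(* Let $g \geq 0$ be an integer and let $a > 1$, $A < 3$ and $\eta>0$ be constants. Then there exists $n_{0}$ such that for all $n \geq n_{0}$ and all integers $m \in [an,An]$, \[ \left| \left( \frac{|\mathcal{S}^{g}(n,m)|}{n!} \right)^{1/n} - \gamma \left( \frac{m}{n} \right) \right| < \eta. \]
   Context: A graph has genus at most $g$ if it can be embedded without crossing edges on an orientable surface of genus $g$. $\mathcal{S}^{g}(n,m)$ is the set of labelled simple graphs on $[n]$ with exactly $m$ edges and genus at most $g$. It is known that there is a continuous function $\gamma:(1,3)\to\mathbb{R}$ such that for every constant integer $g\ge0$ and every constant $q\in(1,3)$, $\left(|\mathcal{S}^{g}(n,\lfloor qn\rfloor)|/n!\right)^{1/n}\to\gamma(q)$ as $n\to\infty$ (the limit does not depend on $g$); this is the $\gamma$ in the statement. *)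

theory Defs
  imports "HOL-Analysis.Analysis"
begin

text \<open>A concrete model of the closed orientable surface of genus \<open>g\<close>, which is unique up to
  homeomorphism. Let \<open>D\<close> be the closed disc of radius \<open>3 * (g + 1)\<close> around the origin of the plane
  with the open discs of radius 1 around the points \<open>(3, 0), (6, 0), \<dots>, (3 * g, 0)\<close> removed; these
  \<open>g\<close> holes have pairwise disjoint closures inside the big open disc. The right-hand side below is
  positive in the interior of \<open>D\<close>, zero (to first order) on its boundary and negative outside \<open>D\<close>.
  Hence the solution set consists of the graphs of two functions \<open>z \<ge> 0\<close> and \<open>z \<le> 0\<close> over \<open>D\<close>, glued
  along the boundary: it is the double of a disc with \<open>g\<close> holes, i.e. a sphere with \<open>g\<close> handles,
  smoothly embedded in three-space. For \<open>g = 0\<close> it is a round sphere.\<close>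

definition genus_surface :: "nat \<Rightarrow> (real \<times> real \<times> real) set" where
  "genus_surface g = {(x, y, z).
     z\<^sup>2 = ((3 * (real g + 1))\<^sup>2 - (x\<^sup>2 + y\<^sup>2)) * (\<Prod>i=1..g. (x - 3 * real i)\<^sup>2 + y\<^sup>2 - 1)}"

lemma genus_surface_0: "genus_surface 0 = {(x, y, z). x\<^sup>2 + y\<^sup>2 + z\<^sup>2 = 3\<^sup>2}"
  by (auto simp: genus_surface_def)

lemma genus_surface_projection:
  "(\<exists>z. (x, y, z) \<in> genus_surface g) \<longleftrightarrow>
     x\<^sup>2 + y\<^sup>2 \<le> (3 * (real g + 1))\<^sup>2 \<and> (\<forall>i\<in>{1..g}. (x - 3 * real i)\<^sup>2 + y\<^sup>2 \<ge> 1)"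
proof -
  define F where "F = (3 * (real g + 1))\<^sup>2 - (x\<^sup>2 + y\<^sup>2)"
  define h where "h i = (x - 3 * real i)\<^sup>2 + y\<^sup>2 - 1" for i
  have ex: "(\<exists>z. (x, y, z) \<in> genus_surface g) \<longleftrightarrow> F * prod h {1..g} \<ge> 0"
  proof
    assume "\<exists>z. (x, y, z) \<in> genus_surface g"
    then obtain z where "z\<^sup>2 = F * prod h {1..g}"
      by (auto simp: genus_surface_def F_def h_def)
    then show "F * prod h {1..g} \<ge> 0" by (metis zero_le_power2)
  next
    assume "F * prod h {1..g} \<ge> 0"
    then have "(sqrt (F * prod h {1..g}))\<^sup>2 = F * prod h {1..g}" by simp
    then show "\<exists>z. (x, y, z) \<in> genus_surface g"
      unfolding genus_surface_def mem_Collect_eq case_prod_conv F_def h_def by blast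
  qed
  have inside: "F > 0 \<and> (\<forall>j\<in>{1..g} - {i}. h j > 0)" if i: "i \<in> {1..g}" and "h i < 0" for i
  proof -
    have lt: "(x - 3 * real i)\<^sup>2 + y\<^sup>2 < 1" using that(2) by (simp add: h_def)
    then have "(x - 3 * real i)\<^sup>2 < 1\<^sup>2" by (smt (verit) zero_le_power2 one_power2)
    then have x: "\<bar>x - 3 * real i\<bar> < 1" by (simp add: abs_square_less_1)
    have y: "y\<^sup>2 < 1" using lt by (smt (verit) zero_le_power2)
    have "real i \<le> real g" "real i \<ge> 1" using i by auto
    then have "0 < x" "x < 3 * real g + 1" using x by linarith+
    then have "x\<^sup>2 \<le> (3 * real g + 1)\<^sup>2" by (intro power_mono) auto
    then have "F > 0" using y
      unfolding F_def by (simp add: power2_eq_square algebra_simps)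
    moreover have "h j > 0" if "j \<noteq> i" for j
    proof -
      have "\<bar>real j - real i\<bar> \<ge> 1" using that by linarith
      then have "\<bar>x - 3 * real j\<bar> > 1" using x by linarith
      then have "(x - 3 * real j)\<^sup>2 > 1\<^sup>2" by (metis power2_abs power_strict_mono zero_le_one zero_less_numeral)
      then show ?thesis unfolding h_def by (smt (verit) zero_le_power2 one_power2)
    qed
    ultimately show ?thesis by auto
  qed
  have "F * prod h {1..g} \<ge> 0 \<longleftrightarrow> F \<ge> 0 \<and> (\<forall>i\<in>{1..g}. h i \<ge> 0)"
  proof (cases "\<exists>i\<in>{1..g}. h i < 0")
    case True
    then obtain i where i: "i \<in> {1..g}" "h i < 0" by auto
    have "prod h ({1..g} - {i}) > 0" using inside[OF i] by (intro prod_pos) auto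
    moreover have "prod h {1..g} = h i * prod h ({1..g} - {i})"
      using i by (simp add: prod.remove)
    ultimately have "F * prod h {1..g} < 0"
      using i inside[OF i] by (simp add: mult_pos_neg mult_neg_pos)
    then show ?thesis using i by force
  next
    case False
    then have nn: "\<forall>i\<in>{1..g}. h i \<ge> 0" by (meson not_less)
    show ?thesis
    proof (cases "F \<ge> 0")
      case True
      moreover have "prod h {1..g} \<ge> 0" using nn by (intro prod_nonneg) blast
      ultimately have "F * prod h {1..g} \<ge> 0" by (rule mult_nonneg_nonneg)
      then show ?thesis using nn True by blast
    next
      case F: False
      have "h i > 0" if i: "i \<in> {1..g}" for i
      proof (rule ccontr)
        assume "\<not> h i > 0"
        then have le: "(x - 3 * real i)\<^sup>2 + y\<^sup>2 \<le> 1" by (simp add: h_def)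
        then have "(x - 3 * real i)\<^sup>2 \<le> 1\<^sup>2" by (smt (verit) zero_le_power2 one_power2)
        then have x: "\<bar>x - 3 * real i\<bar> \<le> 1" by (simp add: abs_square_le_1)
        have y: "y\<^sup>2 \<le> 1" using le by (smt (verit) zero_le_power2)
        have "real i \<le> real g" "real i \<ge> 1" using i by auto
        then have "0 \<le> x" "x \<le> 3 * real g + 1" using x by linarith+
        then have "x\<^sup>2 \<le> (3 * real g + 1)\<^sup>2" by (intro power_mono) auto
        then have "F > 0" using y
          unfolding F_def by (simp add: power2_eq_square algebra_simps)
        then show False using F by simp
      qed
      then have "prod h {1..g} > 0" by (intro prod_pos) auto
      then show ?thesis using F by (auto simp only: zero_le_mult_iff)
    qed
  qed
  then show ?thesis unfolding ex by (simp add: F_def h_def)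
qed

text \<open>A drawing without crossings of the graph with vertex set \<open>V\<close> and edge set \<open>E\<close> on \<open>X\<close>: the vertices
  are distinct points, every edge is a simple arc joining its two ends that meets no other vertex,
  and two distinct edges meet at most in their common ends.\<close>

definition embedding_on ::
    "'a::topological_space set \<Rightarrow> 'v set \<Rightarrow> 'v set set \<Rightarrow> ('v \<Rightarrow> 'a) \<Rightarrow> ('v set \<Rightarrow> real \<Rightarrow> 'a) \<Rightarrow> bool" where
  "embedding_on X V E p c \<longleftrightarrow>
     inj_on p V \<and> p ` V \<subseteq> X \<and>
     (\<forall>e\<in>E. arc (c e) \<and> path_image (c e) \<subseteq> X \<and>
        {pathstart (c e), pathfinish (c e)} = p ` e \<and>
        path_image (c e) \<inter> p ` V = p ` e) \<and>
     (\<forall>e\<in>E. \<forall>f\<in>E. e \<noteq> f \<longrightarrow> path_image (c e) \<inter> path_image (c f) = p ` (e \<inter> f))"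

definition genus_at_most :: "nat \<Rightarrow> 'v set \<Rightarrow> 'v set set \<Rightarrow> bool" where
  "genus_at_most g V E \<longleftrightarrow> (\<exists>p c. embedding_on (genus_surface g) V E p c)"

text \<open>A labelled simple graph on \<open>[n]\<close> is identified with its edge set.\<close>

definition surface_graphs :: "nat \<Rightarrow> nat \<Rightarrow> nat \<Rightarrow> nat set set set" where
  "surface_graphs g n m =
     {E. E \<subseteq> {e. e \<subseteq> {1..n} \<and> card e = 2} \<and> card E = m \<and> genus_at_most g {1..n} E}"

end

theory Submission
  imports Defs "HOL-Real_Asymp.Real_Asymp"
begin

text \<open>Subdividing an edge keeps the genus, so that \<open>|S(n+1,m+1)| \<ge> m |S(n,m)|\<close>, and the normalised count
  \<open>|S(n,m)| / n!\<close> does not decrease along diagonals with \<open>m > n\<close>. The diagonal through \<open>(n,m)\<close>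
  meets the ray \<open>m' = q n'\<close> at \<open>n' = (m - n) / (q - 1)\<close>, before \<open>(n,m)\<close> if \<open>q > m/n\<close> and after it
  if \<open>q < m/n\<close>; deleting at most two edges corrects the rounding at polynomial cost. If
  \<open>m/n \<rightarrow> r\<close> along a sequence, the pointwise limits on the rays thus bound the \<open>n\<close>-th roots by
  \<open>\<gamma>(q) powr ((r - 1) / (q - 1))\<close> from below for \<open>q > r\<close> and from above for \<open>q < r\<close>, and both
  bounds tend to \<open>\<gamma>(r)\<close> as \<open>q \<rightarrow> r\<close>. Uniformity follows by compactness of \<open>[a, A]\<close>.\<close>

section \<open>Subdividing a drawn edge\<close>

text \<open>An arc is injective, so intersections of its pieces are images of intersections of
  parameter intervals. The halves will draw the two edges that replace a subdivided one.\<close>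

lemma half_arcs:
  fixes c :: "real \<Rightarrow> 'a::real_normed_vector"
  assumes "arc c"
  defines "h1 \<equiv> subpath 0 (1/2) c" and "h2 \<equiv> subpath (1/2) 1 c"
  shows "arc h1" "arc h2"
    "pathstart h1 = pathstart c" "pathfinish h1 = c (1/2)"
    "pathstart h2 = c (1/2)" "pathfinish h2 = pathfinish c"
    "path_image h1 \<subseteq> path_image c" "path_image h2 \<subseteq> path_image c"
    "path_image h1 \<inter> path_image h2 = {c (1/2)}"
    "pathfinish c \<notin> path_image h1" "pathstart c \<notin> path_image h2"
    "c (1/2) \<notin> {pathstart c, pathfinish c}"
proof -
  have inj: "inj_on c {0..1}" using assms(1) by (simp add: arc_def)
  have im: "path_image h1 = c ` {0..1/2}" "path_image h2 = c ` {1/2..1}"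
    by (simp_all add: h1_def h2_def path_image_subpath)
  show "arc h1" "arc h2"
    using assms(1) by (auto simp: h1_def h2_def intro: arc_subpath_arc)
  show "pathstart h1 = pathstart c" "pathfinish h1 = c (1/2)"
    "pathstart h2 = c (1/2)" "pathfinish h2 = pathfinish c"
    by (simp_all add: h1_def h2_def pathstart_def pathfinish_def subpath_def)
  show "path_image h1 \<subseteq> path_image c" "path_image h2 \<subseteq> path_image c"
    unfolding im path_image_def[of c] by (intro image_mono; simp)+
  have "path_image h1 \<inter> path_image h2 = c ` ({0..1/2} \<inter> {1/2..1})"
    unfolding im by (rule inj_on_image_Int[OF inj, symmetric]) auto
  also have "{0..1/2} \<inter> {1/2..1::real} = {1/2}" by auto
  finally show "path_image h1 \<inter> path_image h2 = {c (1/2)}" by simp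
  show "pathfinish c \<notin> path_image h1" "pathstart c \<notin> path_image h2"
    unfolding im pathfinish_def pathstart_def using inj by (force dest: inj_onD)+
  show "c (1/2) \<notin> {pathstart c, pathfinish c}"
    unfolding pathfinish_def pathstart_def using inj by (force dest: inj_onD)
qed

text \<open>Taking the image over \<open>e\<close> yields both new edges without fixing an order of
  the ends of \<open>e\<close>.\<close>

definition subdivide :: "'v \<Rightarrow> 'v set set \<Rightarrow> 'v set \<Rightarrow> 'v set set" where
  "subdivide w E e = (E - {e}) \<union> (\<lambda>x. {x, w}) ` e"

text \<open>The new vertex goes to the point of the old arc at parameter 1/2, and the two halves
  become the new edges. All new points lie on the old drawing, so \<open>X\<close> may be any set in
  a normed space.\<close>

lemma embedding_on_subdivide:
  fixes c :: "'v set \<Rightarrow> real \<Rightarrow> 'a::real_normed_vector"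
  assumes emb: "embedding_on X V E p c"
    and E: "E \<subseteq> {e. e \<subseteq> V \<and> card e = 2}" and e: "e \<in> E" and w: "w \<notin> V"
  shows "\<exists>p' c'. embedding_on X (insert w V) (subdivide w E e) p' c'"
proof -
  have inj: "inj_on p V" and pX: "p ` V \<subseteq> X"
    and edge: "\<And>f. f \<in> E \<Longrightarrow> arc (c f) \<and> path_image (c f) \<subseteq> X \<and>
        {pathstart (c f), pathfinish (c f)} = p ` f \<and> path_image (c f) \<inter> p ` V = p ` f"
    and cross: "\<And>f f'. \<lbrakk>f \<in> E; f' \<in> E; f \<noteq> f'\<rbrakk> \<Longrightarrow>
        path_image (c f) \<inter> path_image (c f') = p ` (f \<inter> f')"
    using emb by (auto simp: embedding_on_def)
  have sub: "f \<subseteq> V" if "f \<in> E" for f using E that by auto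
  have "card e = 2" using E e by auto
  then obtain u0 v0 where e0: "e = {u0, v0}" "u0 \<noteq> v0" by (auto simp: card_2_iff)
  \<comment> \<open>The ends are named along the direction of the arc, so that \<open>H1\<close> is
    the half at \<open>u\<close> and \<open>H2\<close> the half at \<open>v\<close>.\<close>
  obtain u v where uv: "e = {u, v}" "u \<noteq> v" "pathstart (c e) = p u" "pathfinish (c e) = p v"
    using edge[OF e] e0 by (auto simp: doubleton_eq_iff)
  have uvV: "u \<in> V" "v \<in> V" using sub[OF e] uv by auto
  have uvw: "u \<noteq> w" "v \<noteq> w" using uvV w by auto
  define x where "x = c e (1/2)"
  define H1 where "H1 = subpath 0 (1/2) (c e)"
  define H2 where "H2 = subpath (1/2) 1 (c e)"
  define p' where "p' = p(w := x)"
  define c' where "c' = c({u, w} := H1, {v, w} := H2)"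
  have arc: "arc (c e)" using edge[OF e] by simp
  note H = half_arcs[OF arc, folded H1_def H2_def x_def, unfolded uv(3,4)]
  have imV: "path_image (c e) \<inter> p ` V = {p u, p v}" and imX: "path_image (c e) \<subseteq> X"
    using edge[OF e] uv by auto
  have pu: "p u \<in> path_image H1" and pv: "p v \<in> path_image H2"
    using pathstart_in_path_image[of H1] pathfinish_in_path_image[of H2] H by auto
  have x: "x \<in> path_image H1" "x \<in> path_image H2" using H(9) by auto
  \<comment> \<open>The old arc passes through no vertex but its ends, and its midpoint is not an
    end.\<close>
  have xV: "x \<notin> p ` V" using imV H(7,12) x by auto
  have pV: "p' ` S = p ` S" if "S \<subseteq> V" for S
    using that w by (auto simp: p'_def)
  have pw: "p' w = x" "p' u = p u" "p' v = p v" using uvw by (auto simp: p'_def)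
  have pins: "p' ` insert w V = insert x (p ` V)" using pV[of V] pw by simp
  \<comment> \<open>Another edge meets the old arc only in images of vertices, and \<open>x\<close>
    is none of them.\<close>
  have xf: "x \<notin> path_image (c f)" if "f \<in> E" "f \<noteq> e" for f
    using cross[OF e that(1)] that xV x H(7) sub[OF e] by auto
  have cf: "c' f = c f" if "f \<in> E" for f
  proof -
    have "w \<notin> f" using sub[OF that] w by auto
    then show ?thesis by (auto simp: c'_def)
  qed
  have ne: "{u, w} \<noteq> {v, w}" using uv uvw by (auto simp: doubleton_eq_iff)
  have c12: "c' {u, w} = H1" "c' {v, w} = H2" using ne by (auto simp: c'_def)
  have new: "subdivide w E e = (E - {e}) \<union> {{u, w}, {v, w}}"
    by (simp add: subdivide_def uv)
  have Hf: "path_image H1 \<inter> path_image (c f) = p' ` ({u, w} \<inter> f)"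
    "path_image H2 \<inter> path_image (c f) = p' ` ({v, w} \<inter> f)" if f: "f \<in> E" "f \<noteq> e" for f
  proof -
    have wf: "w \<notin> f" using sub[OF f(1)] w by auto
    have ef: "path_image (c e) \<inter> path_image (c f) = p ` ({u, v} \<inter> f)"
      using cross[OF e f(1)] f uv by auto
    \<comment> \<open>The other edge can meet \<open>H1\<close> only in an end of \<open>e\<close>,
      and of the two ends only \<open>p u\<close> lies on \<open>H1\<close>.\<close>
    have "path_image H1 \<inter> path_image (c f) = path_image H1 \<inter> (p ` ({u, v} \<inter> f))"
      using ef H(7) by blast
    also have "\<dots> = p ` ({u} \<inter> f)" using pu H(10) by auto
    also have "\<dots> = p' ` ({u, w} \<inter> f)" using wf pw by auto
    finally show "path_image H1 \<inter> path_image (c f) = p' ` ({u, w} \<inter> f)" .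
    have "path_image H2 \<inter> path_image (c f) = path_image H2 \<inter> (p ` ({u, v} \<inter> f))"
      using ef H(8) by blast
    also have "\<dots> = p ` ({v} \<inter> f)" using pv H(11) by auto
    also have "\<dots> = p' ` ({v, w} \<inter> f)" using wf pw by auto
    finally show "path_image H2 \<inter> path_image (c f) = p' ` ({v, w} \<inter> f)" .
  qed
  have H12: "path_image H1 \<inter> path_image H2 = p' ` ({u, w} \<inter> {v, w})"
    using H(9) pw uv uvw by auto
  have V1: "path_image H1 \<inter> insert x (p ` V) = {p u, x}"
  proof -
    have "path_image H1 \<inter> p ` V = path_image H1 \<inter> {p u, p v}" using imV H(7) by blast
    then show ?thesis using pu x H(10) by auto
  qed
  have V2: "path_image H2 \<inter> insert x (p ` V) = {p v, x}"
  proof -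
    have "path_image H2 \<inter> p ` V = path_image H2 \<inter> {p u, p v}" using imV H(8) by blast
    then show ?thesis using pv x H(11) by auto
  qed
  have "inj_on p' (insert w V)"
    using inj w xV by (auto simp: p'_def inj_on_def)
  moreover have "p' ` insert w V \<subseteq> X"
    unfolding pins using pX x H(7) imX by auto
  moreover have "arc (c' f) \<and> path_image (c' f) \<subseteq> X \<and>
      {pathstart (c' f), pathfinish (c' f)} = p' ` f \<and> path_image (c' f) \<inter> p' ` insert w V = p' ` f"
    if "f \<in> subdivide w E e" for f
    using that unfolding new
  proof (elim UnE insertE emptyE)
    assume "f \<in> E - {e}"
    then have f: "f \<in> E" "f \<noteq> e" by auto
    have "path_image (c f) \<inter> insert x (p ` V) = p ` f" using edge[OF f(1)] xf[OF f] by simp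
    then show ?thesis unfolding pins using cf[OF f(1)] edge[OF f(1)] pV[OF sub, OF f(1)] by simp
  next
    assume "f = {u, w}"
    moreover have "path_image H1 \<subseteq> X" using H(7) imX by (rule subset_trans)
    ultimately show ?thesis unfolding pins by (simp add: c12 H V1 pw insert_commute)
  next
    assume "f = {v, w}"
    moreover have "path_image H2 \<subseteq> X" using H(8) imX by (rule subset_trans)
    ultimately show ?thesis unfolding pins by (simp add: c12 H V2 pw insert_commute)
  qed
  moreover have "path_image (c' f) \<inter> path_image (c' f') = p' ` (f \<inter> f')"
    if "f \<in> subdivide w E e" "f' \<in> subdivide w E e" "f \<noteq> f'" for f f'
    using that(1,2) unfolding new
  proof (elim UnE insertE emptyE)
    assume "f \<in> E - {e}" "f' \<in> E - {e}"
    then have f: "f \<in> E" "f' \<in> E" by auto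
    have "f \<inter> f' \<subseteq> V" using sub[OF f(1)] by blast
    then show ?thesis using cross[OF f that(3)] by (simp add: cf f pV)
  qed (use that(3) Hf H12 cf c12 in \<open>simp_all add: Int_commute\<close>)
  ultimately have "embedding_on X (insert w V) (subdivide w E e) p' c'"
    unfolding embedding_on_def by (intro conjI ballI impI) simp_all
  then show ?thesis by blast
qed

section \<open>Counting inequalities from subdividing and deleting edges\<close>

lemma embedding_on_subset:
  "embedding_on X V E p c \<Longrightarrow> F \<subseteq> E \<Longrightarrow> embedding_on X V F p c"
  by (simp add: embedding_on_def subset_iff[of F])

lemma genus_at_most_subset: "genus_at_most g V E \<Longrightarrow> F \<subseteq> E \<Longrightarrow> genus_at_most g V F"
  unfolding genus_at_most_def by (meson embedding_on_subset)

lemma finite_surface_graphs [simp]: "finite (surface_graphs g n m)"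
  by (rule finite_subset[of _ "Pow (Pow {1..n})"]) (auto simp: surface_graphs_def)

lemma finite_surface_graph: "E \<in> surface_graphs g n m \<Longrightarrow> finite E"
  by (rule finite_subset[of _ "Pow {1..n}"]) (auto simp: surface_graphs_def)

lemma subdivide_surface_graphs:
  assumes "E \<in> surface_graphs g n m" "e \<in> E"
  shows "subdivide (Suc n) E e \<in> surface_graphs g (Suc n) (Suc m)"
proof -
  have E: "E \<subseteq> {e. e \<subseteq> {1..n} \<and> card e = 2}" "card E = m" and gen: "genus_at_most g {1..n} E"
    using assms by (auto simp: surface_graphs_def)
  have fin: "finite E" using assms(1) by (rule finite_surface_graph)
  have e: "e \<subseteq> {1..n}" "card e = 2" using E assms by auto
  have ins: "{1..Suc n} = insert (Suc n) {1..n}" by auto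
  obtain p c where "embedding_on (genus_surface g) {1..n} E p c"
    using gen by (auto simp: genus_at_most_def)
  from embedding_on_subdivide[OF this E(1) assms(2), of "Suc n"]
  have "genus_at_most g {1..Suc n} (subdivide (Suc n) E e)"
    unfolding genus_at_most_def ins by simp
  moreover have "subdivide (Suc n) E e \<subseteq> {e. e \<subseteq> {1..Suc n} \<and> card e = 2}"
  proof -
    have "card {x, Suc n} = 2" if "x \<in> e" for x
    proof -
      have "x \<noteq> Suc n" using that e(1) by auto
      then show ?thesis by simp
    qed
    moreover have "f \<subseteq> {1..Suc n}" if "f \<subseteq> {1..n}" for f
      using that by (rule subset_trans) simp
    ultimately show ?thesis using E(1) e(1) unfolding subdivide_def by fastforce
  qed
  moreover have "card (subdivide (Suc n) E e) = Suc m"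
  proof -
    \<comment> \<open>Only the new edges contain \<open>Suc n\<close>. Hence one edge is lost and
      two are gained.\<close>
    have disj: "(E - {e}) \<inter> (\<lambda>x. {x, Suc n}) ` e = {}" using E by force
    have "inj_on (\<lambda>x. {x, Suc n}) e"
      by (auto simp: inj_on_def doubleton_eq_iff)
    then have "card ((\<lambda>x. {x, Suc n}) ` e) = 2" using e by (simp add: card_image)
    moreover have "finite e" using e finite_subset by blast
    moreover have "card E > 0" using fin assms by (auto simp: card_gt_0_iff)
    ultimately show ?thesis
      unfolding subdivide_def using card_Un_disjoint[OF _ _ disj] fin assms E(2)
      by (simp add: card_Diff_singleton)
  qed
  ultimately show ?thesis by (simp add: surface_graphs_def)
qed

text \<open>A subdivided graph remembers its origin: the neighbours of \<open>Suc n\<close> are the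
  ends of \<open>e\<close>, and the edges avoiding \<open>Suc n\<close> are the rest of
  \<open>E\<close>.\<close>

lemma inj_on_subdivide:
  "inj_on (\<lambda>(E, e). subdivide (Suc n) E e) (SIGMA E:surface_graphs g n m. E)"
proof (rule inj_on_inverseI[where g =
    "\<lambda>F. let e = {x. {x, Suc n} \<in> F \<and> x \<noteq> Suc n} in (insert e {f \<in> F. Suc n \<notin> f}, e)"])
  fix Ee assume "Ee \<in> (SIGMA E:surface_graphs g n m. E)"
  then obtain E e where Ee: "Ee = (E, e)" "E \<in> surface_graphs g n m" "e \<in> E" by auto
  have new: "Suc n \<notin> f" if "f \<in> E" for f
    using Ee that by (force simp: surface_graphs_def)
  have e: "{x. {x, Suc n} \<in> subdivide (Suc n) E e \<and> x \<noteq> Suc n} = e"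
    using new Ee by (force simp: subdivide_def doubleton_eq_iff)
  have "insert e {f \<in> subdivide (Suc n) E e. Suc n \<notin> f} = E"
    using new Ee by (auto simp: subdivide_def)
  then show "(let e = {x. {x, Suc n} \<in> (case Ee of (E, e) \<Rightarrow> subdivide (Suc n) E e) \<and> x \<noteq> Suc n}
      in (insert e {f \<in> (case Ee of (E, e) \<Rightarrow> subdivide (Suc n) E e). Suc n \<notin> f}, e)) = Ee"
    by (simp add: Ee(1) e Let_def)
qed

text \<open>Pairs of a graph and one of its edges are counted: each graph has \<open>m\<close> edges
  to subdivide, and distinct pairs give distinct results.\<close>

lemma card_surface_graphs_Suc:
  "m * card (surface_graphs g n m) \<le> card (surface_graphs g (Suc n) (Suc m))"
proof -
  have "card (SIGMA E:surface_graphs g n m. E) = (\<Sum>E\<in>surface_graphs g n m. card E)"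
    using finite_surface_graph by (intro card_SigmaI) auto
  also have "\<dots> = m * card (surface_graphs g n m)"
    by (simp add: surface_graphs_def)
  finally have "m * card (surface_graphs g n m) = card (SIGMA E:surface_graphs g n m. E)" by simp
  also have "\<dots> \<le> card (surface_graphs g (Suc n) (Suc m))"
    by (rule card_inj_on_le[OF inj_on_subdivide]) (auto intro: subdivide_surface_graphs)
  finally show ?thesis .
qed

text \<open>Every graph with \<open>Suc m\<close> edges arises from one with \<open>m\<close> edges
  by inserting some \<open>{x, y}\<close>. Ordered pairs, equal entries included, are counted, hence
  the crude factor \<open>n\<^sup>2\<close>.\<close>

lemma card_surface_graphs_delete:
  "card (surface_graphs g n (Suc m)) \<le> n\<^sup>2 * card (surface_graphs g n m)"
proof -
  define P where "P = {1..n} \<times> {1..n} \<times> surface_graphs g n m"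
  have "surface_graphs g n (Suc m) \<subseteq> (\<lambda>(x, y, E). insert {x, y} E) ` P"
  proof
    fix E assume E: "E \<in> surface_graphs g n (Suc m)"
    then have "card E = Suc m" by (simp add: surface_graphs_def)
    then obtain e where e: "e \<in> E" by fastforce
    then have "e \<subseteq> {1..n}" "card e = 2" using E by (auto simp: surface_graphs_def)
    then obtain x y where xy: "e = {x, y}" "x \<in> {1..n}" "y \<in> {1..n}"
      by (auto simp: card_2_iff)
    have "genus_at_most g {1..n} (E - {e})"
      by (rule genus_at_most_subset[OF _ Diff_subset]) (use E in \<open>simp add: surface_graphs_def\<close>)
    then have "E - {e} \<in> surface_graphs g n m"
      using E e finite_surface_graph[OF E] by (auto simp: surface_graphs_def)
    then have "(x, y, E - {e}) \<in> P" using xy by (simp add: P_def)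
    moreover have "insert {x, y} (E - {e}) = E" using e xy by auto
    ultimately show "E \<in> (\<lambda>(x, y, E). insert {x, y} E) ` P"
      by (intro image_eqI[of _ _ "(x, y, E - {e})"]) simp_all
  qed
  moreover have "finite P" by (simp add: P_def)
  ultimately have "card (surface_graphs g n (Suc m)) \<le> card P"
    by (rule surj_card_le[rotated])
  then show ?thesis by (simp add: P_def card_cartesian_product power2_eq_square)
qed

lemma card_surface_graphs_delete_many:
  "card (surface_graphs g n (m + d)) \<le> n ^ (2 * d) * card (surface_graphs g n m)"
proof (induction d)
  case (Suc d)
  have "card (surface_graphs g n (m + Suc d)) \<le> n\<^sup>2 * card (surface_graphs g n (m + d))"
    using card_surface_graphs_delete[of g n "m + d"] by simp
  also have "\<dots> \<le> n\<^sup>2 * (n ^ (2 * d) * card (surface_graphs g n m))"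
    using Suc by simp
  finally show ?case by (simp add: power2_eq_square mult.assoc)
qed simp

section \<open>Normalised counts and their comparison along diagonals\<close>

text \<open>The root is kept outside, because later a density on \<open>K\<close> vertices is raised
  to the power \<open>1 / N\<close> for another number \<open>N\<close>.\<close>

definition surface_density :: "nat \<Rightarrow> nat \<Rightarrow> nat \<Rightarrow> real" where
  "surface_density g n m = real (card (surface_graphs g n m)) / fact n"

lemma surface_density_nonneg [simp]: "0 \<le> surface_density g n m"
  by (simp add: surface_density_def)

text \<open>Subdividing along the diagonal costs nothing: there are \<open>m \<ge> n + 1\<close> edges to subdivide, which
  outweighs the factor \<open>n + 1\<close> gained by the factorial.\<close>

lemma surface_density_diagonal:
  assumes "n < m"
  shows "surface_density g n m \<le> surface_density g (n + k) (m + k)"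
proof (induction k)
  case (Suc k)
  let ?N = "n + k" and ?M = "m + k"
  have "real (Suc ?N) * card (surface_graphs g ?N ?M) \<le> real ?M * card (surface_graphs g ?N ?M)"
    using assms by (intro mult_right_mono) auto
  also have "\<dots> \<le> card (surface_graphs g (Suc ?N) (Suc ?M))"
    using card_surface_graphs_Suc[of ?M g ?N] by (metis of_nat_le_iff of_nat_mult)
  finally have "surface_density g ?N ?M \<le> surface_density g (Suc ?N) (Suc ?M)"
    by (simp add: surface_density_def divide_simps fact_reduce mult.commute del: of_nat_Suc)
  then show ?case using Suc by simp
qed simp

text \<open>The diagonal leads from \<open>(n, m)\<close> to \<open>(n', m + n' - n)\<close>, where
  at most two edges are deleted to reach \<open>m'\<close>; each deletion costs a factor of at most
  \<open>n' ^ 2\<close>. The last two hypotheses say that this surplus is between 0 and 2, avoiding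
  subtraction of naturals.\<close>

lemma surface_density_compare:
  assumes "n < m" "n \<le> n'" "0 < n'" "m' + n \<le> m + n'" "m + n' \<le> m' + n + 2"
  shows "surface_density g n m \<le> real n' ^ 4 * surface_density g n' m'"
proof -
  define d where "d = m + n' - n - m'"
  have d: "d \<le> 2" "m + (n' - n) = m' + d" using assms by (auto simp: d_def)
  have "surface_density g n m \<le> surface_density g n' (m' + d)"
    using surface_density_diagonal[OF assms(1), of g "n' - n"] assms(2) d by simp
  also have "real (card (surface_graphs g n' (m' + d))) \<le> n' ^ (2 * d) * card (surface_graphs g n' m')"
    using card_surface_graphs_delete_many[of g n' m' d] by (metis of_nat_le_iff of_nat_mult)
  then have "surface_density g n' (m' + d) \<le> real (n' ^ (2 * d)) * surface_density g n' m'"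
    by (simp add: surface_density_def divide_simps)
  also have "\<dots> \<le> real n' ^ 4 * surface_density g n' m'"
    using d assms by (auto intro!: mult_right_mono power_increasing)
  finally show ?thesis .
qed

section \<open>Limits along sequences of vertex numbers\<close>

lemma eventually_pos:
  fixes N :: "nat \<Rightarrow> nat"
  shows "filterlim N at_top F \<Longrightarrow> eventually (\<lambda>j. 0 < N j) F"
  using filterlim_at_top[of N F] by (auto dest!: spec[of _ 1] elim!: eventually_mono)

text \<open>With \<open>s = q - 1\<close>, the quotient \<open>(M j - N j) / s\<close> is the vertex
  number at which the diagonal through \<open>(N j, M j)\<close> meets the ray of slope
  \<open>q\<close>. The tolerance 1 allows rounding up or down and vanishes after division by
  \<open>N j\<close>.\<close>

lemma diagonal_ratio_tendsto:
  fixes K M N :: "nat \<Rightarrow> nat"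
  assumes N: "filterlim N at_top sequentially"
    and MN: "(\<lambda>j. real (M j) / real (N j)) \<longlonglongrightarrow> r"
    and K: "eventually (\<lambda>j. \<bar>real (K j) - (real (M j) - real (N j)) / s\<bar> \<le> 1) sequentially"
  shows "(\<lambda>j. real (K j) / real (N j)) \<longlonglongrightarrow> (r - 1) / s"
proof -
  have N0: "eventually (\<lambda>j. N j > 0) sequentially"
    using N by (rule eventually_pos)
  have "(\<lambda>j. 1 / real (N j)) \<longlonglongrightarrow> 0"
    using filterlim_compose[OF lim_1_over_n N] by simp
  moreover have "eventually (\<lambda>j. norm (real (K j) / real (N j) - (real (M j) / real (N j) - 1) / s)
      \<le> 1 / real (N j)) sequentially"
    using N0 K
  proof eventually_elim
    case (elim j)
    have "real (K j) / real (N j) - (real (M j) / real (N j) - 1) / s =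
        (real (K j) - (real (M j) - real (N j)) / s) / real (N j)"
      using elim(1) by (simp add: diff_divide_distrib mult.commute)
    then show ?case using elim by (simp add: divide_right_mono)
  qed
  ultimately have "(\<lambda>j. real (K j) / real (N j) - (real (M j) / real (N j) - 1) / s) \<longlonglongrightarrow> 0"
    by (rule Lim_null_comparison[rotated])
  moreover have "(\<lambda>j. (real (M j) / real (N j) - 1) / s) \<longlonglongrightarrow> (r - 1) / s"
    unfolding divide_inverse[of _ s] using MN by (intro tendsto_intros)
  ultimately show ?thesis using tendsto_add by fastforce
qed

lemma filterlim_at_top_of_ratio:
  fixes K N :: "nat \<Rightarrow> nat"
  assumes N: "filterlim N at_top sequentially"
    and KN: "(\<lambda>j. real (K j) / real (N j)) \<longlonglongrightarrow> \<theta>" "\<theta> > 0"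
  shows "filterlim K at_top sequentially"
proof -
  have "filterlim (\<lambda>j. real (K j) / real (N j) * real (N j)) at_top sequentially"
    using filterlim_compose[OF filterlim_real_sequentially N]
    by (rule filterlim_tendsto_pos_mult_at_top[OF KN])
  moreover have "eventually (\<lambda>j. real (K j) / real (N j) * real (N j) = real (K j)) sequentially"
  proof -
    have "eventually (\<lambda>j. N j > 0) sequentially"
      using N by (rule eventually_pos)
    then show ?thesis by eventually_elim simp
  qed
  ultimately have "filterlim (\<lambda>j. real (K j)) at_top sequentially"
    by (simp cong: filterlim_cong)
  then show ?thesis by (simp add: filterlim_sequentially_iff_filterlim_real)
qed

text \<open>This removes the polynomial factors caused by deleting edges: the root of order
  \<open>N j\<close> is the root of order \<open>K j\<close> raised to \<open>K j / N j\<close>, and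
  \<open>1 powr \<theta> = 1\<close>.\<close>

lemma power_powr_inverse_tendsto_1:
  fixes K N :: "nat \<Rightarrow> nat"
  assumes N: "filterlim N at_top sequentially"
    and KN: "(\<lambda>j. real (K j) / real (N j)) \<longlonglongrightarrow> \<theta>" "\<theta> > 0"
  shows "(\<lambda>j. (real (K j) ^ d) powr (1 / real (N j))) \<longlonglongrightarrow> 1"
proof -
  have K: "filterlim K at_top sequentially" using assms by (rule filterlim_at_top_of_ratio)
  have "(\<lambda>n. (real n ^ d) powr (1 / real n)) \<longlonglongrightarrow> 1" by real_asymp
  then have "(\<lambda>j. ((real (K j) ^ d) powr (1 / real (K j))) powr (real (K j) / real (N j))) \<longlonglongrightarrow> 1 powr \<theta>"
    using KN by (intro tendsto_powr filterlim_compose[OF _ K]) auto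
  moreover have "eventually (\<lambda>j. K j > 0) sequentially"
    using K by (rule eventually_pos)
  then have "eventually (\<lambda>j. ((real (K j) ^ d) powr (1 / real (K j))) powr (real (K j) / real (N j))
      = (real (K j) ^ d) powr (1 / real (N j))) sequentially"
    by eventually_elim (simp add: powr_powr)
  ultimately have "(\<lambda>j. (real (K j) ^ d) powr (1 / real (N j))) \<longlonglongrightarrow> 1 powr \<theta>"
    by (simp cong: tendsto_cong)
  then show ?thesis by simp
qed

section \<open>The limit function and convergence along sequences\<close>

locale surface_limit =
  fixes \<gamma> :: "real \<Rightarrow> real" and g :: nat
  assumes cont: "continuous_on {1<..<3} \<gamma>"
    and lim: "\<And>q. \<lbrakk>1 < q; q < 3\<rbrakk> \<Longrightarrow>
      (\<lambda>n. surface_density g n (nat \<lfloor>q * real n\<rfloor>) powr (1 / real n)) \<longlonglongrightarrow> \<gamma> q"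
begin

lemma gamma_nonneg: "\<lbrakk>1 < q; q < 3\<rbrakk> \<Longrightarrow> 0 \<le> \<gamma> q"
  by (rule LIMSEQ_le_const[OF lim]) auto

text \<open>The root of order \<open>N j\<close> is the root of order \<open>K j\<close> raised to
  \<open>K j / N j\<close>, which turns the limit \<open>\<gamma> q\<close> into
  \<open>\<gamma> q powr \<theta>\<close>.\<close>

lemma lim_along:
  assumes q: "1 < q" "q < 3" and N: "filterlim N at_top sequentially"
    and KN: "(\<lambda>j. real (K j) / real (N j)) \<longlonglongrightarrow> \<theta>" "\<theta> > 0"
  shows "(\<lambda>j. surface_density g (K j) (nat \<lfloor>q * real (K j)\<rfloor>) powr (1 / real (N j)))
    \<longlonglongrightarrow> \<gamma> q powr \<theta>"
proof -
  let ?t = "\<lambda>j. surface_density g (K j) (nat \<lfloor>q * real (K j)\<rfloor>)"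
  have K: "filterlim K at_top sequentially" using N KN by (rule filterlim_at_top_of_ratio)
  have "(\<lambda>j. ?t j powr (1 / real (K j))) \<longlonglongrightarrow> \<gamma> q"
    using filterlim_compose[OF lim[OF q] K] .
  \<comment> \<open>The value \<open>\<gamma> q = 0\<close> is not excluded, so continuity of
    \<open>powr\<close> at base 0 is used; it needs a positive limit of the exponents.\<close>
  then have "(\<lambda>j. (?t j powr (1 / real (K j))) powr (real (K j) / real (N j))) \<longlonglongrightarrow> \<gamma> q powr \<theta>"
    by (rule tendsto_powr2) (use KN in auto)
  moreover have "eventually (\<lambda>j. K j > 0) sequentially"
    using K by (rule eventually_pos)
  then have "eventually (\<lambda>j. (?t j powr (1 / real (K j))) powr (real (K j) / real (N j))
      = ?t j powr (1 / real (N j))) sequentially"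
    by eventually_elim (simp add: powr_powr)
  ultimately show ?thesis by (simp cong: tendsto_cong)
qed

lemma isCont_gamma: "\<lbrakk>1 < r; r < 3\<rbrakk> \<Longrightarrow> isCont \<gamma> r"
  using cont by (simp add: continuous_on_eq_continuous_at)

text \<open>The exponent tends to 1, so bounds obtained from rays on either side of \<open>r\<close>
  close up to \<open>\<gamma> r\<close>.\<close>

lemma gamma_powr_tendsto:
  assumes r: "1 < r" "r < 3"
  shows "((\<lambda>q. \<gamma> q powr ((r - 1) / (q - 1))) \<longlongrightarrow> \<gamma> r) (at r)"
proof -
  have "(\<gamma> \<longlongrightarrow> \<gamma> r) (at r)" using isCont_gamma[OF r] by (simp add: isCont_def)
  moreover have "((\<lambda>q. (r - 1) / (q - 1)) \<longlongrightarrow> (r - 1) / (r - 1)) (at r)"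
    using r by (intro tendsto_intros) auto
  moreover have "eventually (\<lambda>q. 0 \<le> \<gamma> q) (at r)"
  proof -
    have "eventually (\<lambda>q. q \<in> {1<..<3}) (at r)"
      using r by (intro eventually_at_in_open') auto
    then show ?thesis by eventually_elim (simp add: gamma_nonneg)
  qed
  ultimately have "((\<lambda>q. \<gamma> q powr ((r - 1) / (q - 1))) \<longlongrightarrow> \<gamma> r powr ((r - 1) / (r - 1))) (at r)"
    using r by (intro tendsto_powr2) auto
  then show ?thesis using r gamma_nonneg[OF r] by simp
qed

text \<open>Each \<open>x\<close> on one side of \<open>\<gamma> r\<close> is handled with a single
  fixed slope \<open>q\<close> near \<open>r\<close>; only \<open>j\<close> then tends to
  infinity.\<close>

lemma density_tendsto:
  assumes N: "filterlim N at_top sequentially"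
    and MN: "(\<lambda>j. real (M j) / real (N j)) \<longlonglongrightarrow> r" and r: "1 < r" "r < 3"
  shows "(\<lambda>j. surface_density g (N j) (M j) powr (1 / real (N j))) \<longlonglongrightarrow> \<gamma> r"
proof -
  let ?T = "\<lambda>j. surface_density g (N j) (M j) powr (1 / real (N j))"
  have N0: "eventually (\<lambda>j. N j > 0) sequentially"
    using N by (rule eventually_pos)
  have "eventually (\<lambda>j. 1 < real (M j) / real (N j)) sequentially"
    using MN r by (auto dest: order_tendstoD)
  with N0 have NM: "eventually (\<lambda>j. N j < M j) sequentially"
    by eventually_elim (simp add: field_simps)
  show ?thesis
  proof (rule order_tendstoI)
    fix x assume x: "x < \<gamma> r"
    \<comment> \<open>Lower bound: some \<open>q > r\<close> still keeps the limiting bound above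
      \<open>x\<close>.\<close>
    have "eventually (\<lambda>q. x < \<gamma> q powr ((r - 1) / (q - 1))) (at_right r)"
      using gamma_powr_tendsto[OF r] x by (intro order_tendstoD) (auto simp: filterlim_at_split)
    moreover have "eventually (\<lambda>q. q \<in> {r<..<3}) (at_right r)"
      using r by (intro eventually_at_right_real)
    ultimately have "eventually (\<lambda>q. x < \<gamma> q powr ((r - 1) / (q - 1)) \<and> q \<in> {r<..<3}) (at_right r)"
      by (rule eventually_conj)
    then obtain q where q: "x < \<gamma> q powr ((r - 1) / (q - 1))" "r < q" "q < 3"
      by (auto dest: eventually_happens)
    \<comment> \<open>Rounding up gives \<open>(q - 1) * K j \<ge> M j - N j\<close>, so that the
      start \<open>(K j, L j)\<close> is on or above the diagonal through \<open>(N j, M j)\<close>,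
      even after the floor in \<open>L j\<close>.\<close>
    define K where "K j = nat \<lceil>(real (M j) - real (N j)) / (q - 1)\<rceil>" for j
    define L where "L j = nat \<lfloor>q * real (K j)\<rfloor>" for j
    have K: "eventually (\<lambda>j. real (K j) \<ge> (real (M j) - real (N j)) / (q - 1) \<and>
        real (K j) < (real (M j) - real (N j)) / (q - 1) + 1) sequentially"
      using NM
    proof eventually_elim
      case (elim j)
      then have "(real (M j) - real (N j)) / (q - 1) \<ge> 0" using q r by simp
      then show ?case unfolding K_def by linarith
    qed
    have \<theta>: "(r - 1) / (q - 1) > 0" using q r by simp
    have KN: "(\<lambda>j. real (K j) / real (N j)) \<longlonglongrightarrow> (r - 1) / (q - 1)"
      by (rule diagonal_ratio_tendsto[OF N MN], rule eventually_mono[OF K]) linarith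
    have "filterlim (\<lambda>j. real (K j)) at_top sequentially"
      using filterlim_at_top_of_ratio[OF N KN \<theta>]
      by (simp add: filterlim_sequentially_iff_filterlim_real)
    \<comment> \<open>This ensures \<open>K j < L j\<close>, the condition for moving up the
      diagonal from \<open>(K j, L j)\<close>.\<close>
    then have Kbig: "eventually (\<lambda>j. real (K j) > 1 / (q - 1)) sequentially"
      by (auto simp: filterlim_at_top_dense)
    have "eventually (\<lambda>j. real (M j) / real (N j) < q) sequentially"
      using MN q by (auto dest: order_tendstoD)
    with N0 NM K Kbig have "eventually (\<lambda>j. surface_density g (K j) (L j) powr (1 / real (N j)) /
        (real (N j) ^ 4) powr (1 / real (N j)) \<le> ?T j) sequentially"
    proof eventually_elim
      case (elim j)
      have q1: "q - 1 > 0" using q r by simp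
      have L: "real (L j) \<le> q * real (K j)" "q * real (K j) < real (L j) + 1"
      proof -
        have "q * real (K j) \<ge> 0" using q r by simp
        then show "real (L j) \<le> q * real (K j)" "q * real (K j) < real (L j) + 1"
          unfolding L_def by linarith+
      qed
      have K1: "real (M j) - real (N j) \<le> q * real (K j) - real (K j)"
        "q * real (K j) - real (K j) < real (M j) - real (N j) + (q - 1)"
        "1 < q * real (K j) - real (K j)"
        using elim q1 by (auto simp: field_simps)
      \<comment> \<open>The point \<open>(N j, M j)\<close> lies below the ray of slope
        \<open>q\<close>, so the crossing comes no later than \<open>N j\<close>.\<close>
      have "(real (M j) - real (N j)) / (q - 1) \<le> real (N j)"
        using elim q1 by (simp add: field_simps)
      then have "K j \<le> N j" unfolding K_def by (simp add: ceiling_le_iff)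
      moreover have "real (K j) < real (L j)" using K1 L by linarith
      then have "K j < L j" by simp
      \<comment> \<open>A strict inequality between integers absorbs the rounding error of
        \<open>L j\<close>.\<close>
      moreover have "real (M j) + real (K j) < real (L j) + real (N j) + 1" using K1 L by linarith
      then have "M j + K j \<le> L j + N j" by linarith
      \<comment> \<open>Rounding \<open>K j\<close> up adds less than \<open>q - 1\<close> to the
        edge excess, which is below 2 because \<open>q < 3\<close>.\<close>
      moreover have "real (L j) + real (N j) < real (M j) + real (K j) + 2" using K1 L q by linarith
      then have "L j + N j \<le> M j + K j + 2" by linarith
      ultimately have "surface_density g (K j) (L j) \<le> real (N j) ^ 4 * surface_density g (N j) (M j)"
        using elim by (intro surface_density_compare) auto
      then have "surface_density g (K j) (L j) powr (1 / real (N j))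
          \<le> (real (N j) ^ 4 * surface_density g (N j) (M j)) powr (1 / real (N j))"
        by (intro powr_mono2) auto
      also have "\<dots> = (real (N j) ^ 4) powr (1 / real (N j)) * ?T j"
        by (simp add: powr_mult)
      finally show ?case using elim(1) by (simp add: field_simps)
    qed
    moreover have "(\<lambda>j. surface_density g (K j) (L j) powr (1 / real (N j)) /
        (real (N j) ^ 4) powr (1 / real (N j))) \<longlonglongrightarrow> \<gamma> q powr ((r - 1) / (q - 1)) / 1"
    proof (rule tendsto_divide)
      show "(\<lambda>j. surface_density g (K j) (L j) powr (1 / real (N j))) \<longlonglongrightarrow> \<gamma> q powr ((r - 1) / (q - 1))"
        unfolding L_def using q r \<theta> by (intro lim_along[OF _ _ N KN]) auto
      \<comment> \<open>The case \<open>K = N\<close>, with limit ratio 1.\<close>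
      have "(\<lambda>j. real (N j) / real (N j)) \<longlonglongrightarrow> 1"
        by (rule tendsto_eventually, rule eventually_mono[OF N0]) simp
      then show "(\<lambda>j. (real (N j) ^ 4) powr (1 / real (N j))) \<longlonglongrightarrow> 1"
        by (rule power_powr_inverse_tendsto_1[OF N]) simp
    qed simp
    then have "eventually (\<lambda>j. x < surface_density g (K j) (L j) powr (1 / real (N j)) /
        (real (N j) ^ 4) powr (1 / real (N j))) sequentially"
      using q by (intro order_tendstoD) auto
    ultimately show "eventually (\<lambda>j. x < ?T j) sequentially"
      by eventually_elim linarith
  next
    fix x assume x: "\<gamma> r < x"
    \<comment> \<open>Upper bound: some \<open>q < r\<close> still keeps the limiting bound below
      \<open>x\<close>.\<close>
    have "eventually (\<lambda>q. \<gamma> q powr ((r - 1) / (q - 1)) < x) (at_left r)"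
      using gamma_powr_tendsto[OF r] x by (intro order_tendstoD) (auto simp: filterlim_at_split)
    moreover have "eventually (\<lambda>q. q \<in> {1<..<r}) (at_left r)"
      using r by (intro eventually_at_left_real)
    ultimately have "eventually (\<lambda>q. \<gamma> q powr ((r - 1) / (q - 1)) < x \<and> q \<in> {1<..<r}) (at_left r)"
      by (rule eventually_conj)
    then obtain q where q: "\<gamma> q powr ((r - 1) / (q - 1)) < x" "1 < q" "q < r"
      by (auto dest: eventually_happens)
    \<comment> \<open>Now \<open>(K j, L j)\<close> is the end of the comparison, where surplus
      edges are deleted. Rounding down gives \<open>L j - K j \<le> M j - N j\<close>, so the
      surplus is not negative.\<close>
    define K where "K j = nat \<lfloor>(real (M j) - real (N j)) / (q - 1)\<rfloor>" for j
    define L where "L j = nat \<lfloor>q * real (K j)\<rfloor>" for j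
    have K: "eventually (\<lambda>j. real (K j) \<le> (real (M j) - real (N j)) / (q - 1) \<and>
        real (K j) + 1 > (real (M j) - real (N j)) / (q - 1)) sequentially"
      using NM
    proof eventually_elim
      case (elim j)
      then have "(real (M j) - real (N j)) / (q - 1) \<ge> 0" using q r by simp
      then show ?case unfolding K_def by linarith
    qed
    have \<theta>: "(r - 1) / (q - 1) > 0" using q r by simp
    have KN: "(\<lambda>j. real (K j) / real (N j)) \<longlonglongrightarrow> (r - 1) / (q - 1)"
      by (rule diagonal_ratio_tendsto[OF N MN], rule eventually_mono[OF K]) linarith
    have "eventually (\<lambda>j. q < real (M j) / real (N j)) sequentially"
      using MN q by (auto dest: order_tendstoD)
    with N0 NM K have "eventually (\<lambda>j. ?T j \<le> (real (K j) ^ 4) powr (1 / real (N j)) *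
        surface_density g (K j) (L j) powr (1 / real (N j))) sequentially"
    proof eventually_elim
      case (elim j)
      have q1: "q - 1 > 0" using q by simp
      have L: "real (L j) \<le> q * real (K j)" "q * real (K j) < real (L j) + 1"
      proof -
        have "q * real (K j) \<ge> 0" using q by simp
        then show "real (L j) \<le> q * real (K j)" "q * real (K j) < real (L j) + 1"
          unfolding L_def by linarith+
      qed
      have K1: "q * real (K j) - real (K j) \<le> real (M j) - real (N j)"
        "real (M j) - real (N j) < q * real (K j) - real (K j) + (q - 1)"
        using elim q1 by (auto simp: field_simps)
      have "real (N j) \<le> (real (M j) - real (N j)) / (q - 1)"
        using elim q1 by (simp add: field_simps)
      then have "N j \<le> K j" unfolding K_def by (simp add: le_nat_floor)
      moreover have "real (L j) + real (N j) \<le> real (M j) + real (K j)" using K1 L by linarith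
      then have "L j + N j \<le> M j + K j" by linarith
      \<comment> \<open>Two errors add up: less than \<open>q - 1 < 2\<close> from
        \<open>K j\<close> and less than 1 from \<open>L j\<close>. By integrality the surplus is at
        most 2.\<close>
      moreover have "real (M j) + real (K j) < real (L j) + real (N j) + 3" using K1 L q r by linarith
      then have "M j + K j \<le> L j + N j + 2" by linarith
      ultimately have "surface_density g (N j) (M j) \<le> real (K j) ^ 4 * surface_density g (K j) (L j)"
        using elim by (intro surface_density_compare) auto
      then have "?T j \<le> (real (K j) ^ 4 * surface_density g (K j) (L j)) powr (1 / real (N j))"
        by (intro powr_mono2) auto
      then show ?case by (simp add: powr_mult)
    qed
    moreover have "(\<lambda>j. (real (K j) ^ 4) powr (1 / real (N j)) *
        surface_density g (K j) (L j) powr (1 / real (N j))) \<longlonglongrightarrow> 1 * \<gamma> q powr ((r - 1) / (q - 1))"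
    proof (rule tendsto_mult)
      show "(\<lambda>j. surface_density g (K j) (L j) powr (1 / real (N j))) \<longlonglongrightarrow> \<gamma> q powr ((r - 1) / (q - 1))"
        unfolding L_def using q r \<theta> by (intro lim_along[OF _ _ N KN]) auto
      show "(\<lambda>j. (real (K j) ^ 4) powr (1 / real (N j))) \<longlonglongrightarrow> 1"
        using N KN \<theta> by (rule power_powr_inverse_tendsto_1)
    qed
    then have "eventually (\<lambda>j. (real (K j) ^ 4) powr (1 / real (N j)) *
        surface_density g (K j) (L j) powr (1 / real (N j)) < x) sequentially"
      using q by (intro order_tendstoD) auto
    ultimately show "eventually (\<lambda>j. ?T j < x) sequentially"
      by eventually_elim linarith
  qed
qed

end

section \<open>Uniformity by compactness\<close>

theorem theorem7p4:
  fixes \<gamma> :: "real \<Rightarrow> real" and g :: nat and a A \<eta> :: real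
  assumes gamma_cont: "continuous_on {1<..<3} \<gamma>"
    and gamma_limit: "\<And>(h::nat) (q::real). 1 < q \<Longrightarrow> q < 3 \<Longrightarrow>
      (\<lambda>n. (real (card (surface_graphs h n (nat \<lfloor>q * real n\<rfloor>))) / fact n) powr (1 / real n))
        \<longlonglongrightarrow> \<gamma> q"
    and "a > 1" and "A < 3" and "\<eta> > 0"
  shows "\<exists>n0. \<forall>n\<ge>n0. \<forall>m::nat. a * real n \<le> real m \<and> real m \<le> A * real n \<longrightarrow>
    \<bar>(real (card (surface_graphs g n m)) / fact n) powr (1 / real n) - \<gamma> (real m / real n)\<bar> < \<eta>"
proof (rule ccontr)
  interpret surface_limit \<gamma> g
    using gamma_cont gamma_limit by unfold_locales (auto simp: surface_density_def)
  assume "\<not> ?thesis"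
  \<comment> \<open>The \<open>j\<close>-th counterexample is taken with more than \<open>j\<close>
    vertices, so that \<open>N\<close> is positive and tends to infinity.\<close>
  then have "\<forall>j. \<exists>n m. Suc j \<le> n \<and> a * real n \<le> real m \<and> real m \<le> A * real n \<and>
      \<eta> \<le> \<bar>surface_density g n m powr (1 / real n) - \<gamma> (real m / real n)\<bar>"
    unfolding surface_density_def by (meson not_less)
  then obtain N M where NM: "\<And>j. Suc j \<le> N j" "\<And>j. a * real (N j) \<le> real (M j)"
      "\<And>j. real (M j) \<le> A * real (N j)"
      "\<And>j. \<eta> \<le> \<bar>surface_density g (N j) (M j) powr (1 / real (N j)) - \<gamma> (real (M j) / real (N j))\<bar>"
    by metis
  have "real (M j) / real (N j) \<in> {a..A}" for j
  proof -
    have "0 < N j" using NM(1)[of j] by linarith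
    then show ?thesis using NM(2,3)[of j] by (simp add: field_simps)
  qed
  then obtain r \<phi> where r: "r \<in> {a..A}" and \<phi>: "strict_mono (\<phi> :: nat \<Rightarrow> nat)"
    and MN: "((\<lambda>j. real (M j) / real (N j)) \<circ> \<phi>) \<longlonglongrightarrow> r"
    using compact_Icc[of a A] unfolding compact_def by meson
  have r13: "1 < r" "r < 3" using r assms by auto
  have "filterlim N at_top sequentially"
    by (rule filterlim_at_top_mono[OF filterlim_Suc]) (simp add: NM)
  then have "filterlim (\<lambda>j. N (\<phi> j)) at_top sequentially"
    by (rule filterlim_compose) (rule filterlim_subseq[OF \<phi>])
  then have "(\<lambda>j. surface_density g (N (\<phi> j)) (M (\<phi> j)) powr (1 / real (N (\<phi> j)))) \<longlonglongrightarrow> \<gamma> r"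
    using MN r13 by (intro density_tendsto) (auto simp: o_def)
  \<comment> \<open>The value compared with also moves with \<open>j\<close>; continuity at
    \<open>r\<close> gives it the same limit.\<close>
  moreover have "(\<lambda>j. \<gamma> (real (M (\<phi> j)) / real (N (\<phi> j)))) \<longlonglongrightarrow> \<gamma> r"
    using isCont_tendsto_compose[OF isCont_gamma[OF r13]] MN by (simp add: o_def)
  ultimately have "(\<lambda>j. \<bar>surface_density g (N (\<phi> j)) (M (\<phi> j)) powr (1 / real (N (\<phi> j)))
      - \<gamma> (real (M (\<phi> j)) / real (N (\<phi> j)))\<bar>) \<longlonglongrightarrow> \<bar>\<gamma> r - \<gamma> r\<bar>"
    by (intro tendsto_intros)
  then have "\<eta> \<le> \<bar>\<gamma> r - \<gamma> r\<bar>"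
    by (rule LIMSEQ_le_const) (use NM in auto)
  then show False using \<open>\<eta> > 0\<close> by simp
qed

end
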